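(* For every $c\in[0,1)$, $$\frac{\phi_q(c)}{\psi_q(c)}\to 1\quad\text{as } q\to\infty,$$ where $q$ ranges over the integers $q\ge 2$ and $c$ is fixed.
   Context: For an integer $q\ge2$ and $c\in[0,1)$ let $F_c^q=\{x\in[0,1) : \{q^nx\}\ge c\text{ for all integers } n\ge0\}$, where $\{\cdot\}$ denotes the fractional part, and let $\phi_q(c)=\dim_H F_c^q$ be its Hausdorff dimension. Define $\psi_q:[0,1)\to[0,1]$ by $\psi_q(c)=1+\frac{\log(1-c)}{\log q}$ if $0\le c<\frac{q-1}{q}$, and $\psi_q(c)=0$ otherwise. (For fixed $c$, $\psi_q(c)>0$ for all sufficiently large $q$, so the quotient is defined for all large $q$.) *)

theory Defs
  imports "HOL-Analysis.Analysis"
begin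

text \<open>
  The weight of a covering set in the \<open>s\<close>-dimensional Hausdorff (outer) measure, with the usual
  conventions that the empty set has weight \<open>0\<close> and a nonempty set has weight \<open>1\<close> for \<open>s = 0\<close>.
  The case distinction is needed because \<open>0 powr 0 = 0\<close>.
\<close>

definition hausdorff_weight :: "real \<Rightarrow> 'a::metric_space set \<Rightarrow> ennreal" where
  "hausdorff_weight s U =
     (if U = {} then 0 else if s = 0 then 1 else ennreal (diameter U powr s))"

text \<open>
  Boundedness is required explicitly because \<^const>\<open>diameter\<close> has no meaningful value on
  unbounded sets. Members of a cover may be empty, so finite covers are included.
\<close>

definition delta_covers :: "real \<Rightarrow> 'a::metric_space set \<Rightarrow> (nat \<Rightarrow> 'a set) set" where
  "delta_covers \<delta> S =
     {U. S \<subseteq> (\<Union>i. U i) \<and> (\<forall>i. bounded (U i) \<and> diameter (U i) \<le> \<delta>)}"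

definition hausdorff_premeasure :: "real \<Rightarrow> real \<Rightarrow> 'a::metric_space set \<Rightarrow> ennreal" where
  "hausdorff_premeasure s \<delta> S = (INF U\<in>delta_covers \<delta> S. \<Sum>i. hausdorff_weight s (U i))"

definition hausdorff_measure :: "real \<Rightarrow> 'a::metric_space set \<Rightarrow> ennreal" where
  "hausdorff_measure s S = (SUP \<delta>\<in>{0<..}. hausdorff_premeasure s \<delta> S)"

definition hausdorff_dim :: "'a::metric_space set \<Rightarrow> ennreal" where
  "hausdorff_dim S = (INF s\<in>{s::real. 0 \<le> s \<and> hausdorff_measure s S = 0}. ennreal s)"

definition F_set :: "nat \<Rightarrow> real \<Rightarrow> real set" where
  "F_set q c = {x \<in> {0..<1}. \<forall>n::nat. frac (real q ^ n * x) \<ge> c}"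

text \<open>
  Subsets of the real line have Hausdorff dimension at most \<open>1\<close>, so the conversion to a real
  number loses nothing.
\<close>

definition phi :: "nat \<Rightarrow> real \<Rightarrow> real" where
  "phi q c = enn2real (hausdorff_dim (F_set q c))"

definition psi :: "nat \<Rightarrow> real \<Rightarrow> real" where
  "psi q c = (if c < (real q - 1) / real q then 1 + ln (1 - c) / ln (real q) else 0)"

end

theory Submission
  imports Defs "HOL-Real_Asymp.Real_Asymp"
begin

text \<open>
  For fixed \<open>c\<close> both \<open>psi q c\<close> and \<open>phi q c\<close> tend to \<open>1\<close>. For \<open>psi\<close> this is visible from its
  formula. For \<open>phi\<close> the upper bound \<open>1\<close> is the one that every subset of the unit interval satisfies,
  so everything rests on a lower bound for the dimension.

  A number all of whose base-\<open>q\<close> digits are at least \<open>k \<ge> c q\<close> lies in \<open>F_set q c\<close>, because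
  \<open>frac (q^n x)\<close> is at least its leading digit divided by \<open>q\<close>. If \<open>M\<close> digits are
  allowed, the set of such numbers should have dimension \<open>ln M / ln q\<close>. To bound the dimension from
  below without constructing a measure on this set, the unit interval is mapped into it: write
  \<open>y\<close> in base \<open>M\<close>, add \<open>k\<close> to every digit, and read the result in base \<open>q\<close> (\<open>transcode\<close>). The
  inverse of this map is Hoelder continuous with exponent \<open>ln M / ln q\<close> (\<open>transcode_holder\<close>), so a
  cover of the image with small total weight would pull back to a cover of the unit interval with
  total length below \<open>1\<close> (\<open>hausdorff_dim_ge_if_inverse_holder\<close>).

  One can take \<open>M \<ge> (1 - c) q - 2\<close>, and therefore \<open>ln M / ln q\<close> tends to \<open>1\<close>.
\<close>

section \<open>Bounds for the Hausdorff dimension\<close>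

lemma hausdorff_measure_unit_interval_eq_0:
  fixes S :: "real set"
  assumes S: "S \<subseteq> {0..<1}" and s: "s > 1"
  shows "hausdorff_measure s S = 0"
proof -
  have "hausdorff_premeasure s \<delta> S \<le> 0" if \<delta>: "\<delta> > 0" for \<delta>
  proof (rule tendsto_lowerbound)
    show "(\<lambda>n. ennreal (real n * (1 / real n) powr s)) \<longlonglongrightarrow> 0"
      unfolding ennreal_0[symmetric] by (rule tendsto_ennrealI) (use s in real_asymp)
    have "\<forall>\<^sub>F n in sequentially. 1 / real n < \<delta>"
      using \<delta> by real_asymp
    then show "\<forall>\<^sub>F n in sequentially.
        hausdorff_premeasure s \<delta> S \<le> ennreal (real n * (1 / real n) powr s)"
      using eventually_gt_at_top[of 0]
    proof eventually_elim
      case (elim n)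
      define U where "U i = (if i < n then {real i / n..(real i + 1) / n} else {})" for i
      have diam: "diameter (U i) = (if i < n then 1 / n else 0)" for i
        using elim by (auto simp: U_def field_simps)
      have "x \<in> (\<Union>i. U i)" if "x \<in> S" for x
      proof -
        have x: "0 \<le> x" "x < 1" using that S by auto
        define i where "i = nat \<lfloor>n * x\<rfloor>"
        have i: "real i \<le> n * x" "n * x < real i + 1"
          using x by (auto simp: i_def)
        moreover have "n * x < n" using x elim by simp
        ultimately have "i < n" by linarith
        then have "x \<in> U i" using i elim by (auto simp: U_def field_simps)
        then show ?thesis by blast
      qed
      then have "U \<in> delta_covers \<delta> S"
        using elim \<delta> diam by (auto simp: delta_covers_def) (auto simp: U_def)
      then have "hausdorff_premeasure s \<delta> S \<le> (\<Sum>i. hausdorff_weight s (U i))"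
        unfolding hausdorff_premeasure_def by (rule INF_lower)
      also have "\<dots> = (\<Sum>i<n. hausdorff_weight s (U i))"
        by (rule suminf_finite) (auto simp: U_def hausdorff_weight_def)
      also have "\<dots> \<le> (\<Sum>i<n. ennreal ((1 / n) powr s))"
        by (rule sum_mono) (use s in \<open>auto simp: hausdorff_weight_def diam\<close>)
      also have "\<dots> = ennreal (real n * (1 / real n) powr s)"
        by (simp add: ennreal_mult ennreal_of_nat_eq_real_of_nat)
      finally show ?case .
    qed
  qed auto
  then show ?thesis
    by (auto simp: hausdorff_measure_def SUP_eq_iff intro!: antisym SUP_least)
qed

lemma hausdorff_dim_unit_interval_le_1:
  fixes S :: "real set"
  assumes "S \<subseteq> {0..<1}"
  shows "hausdorff_dim S \<le> 1"
proof (rule ennreal_le_epsilon)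
  fix e :: real assume "e > 0"
  then have "hausdorff_measure (1 + e) S = 0"
    using hausdorff_measure_unit_interval_eq_0[OF assms] by simp
  then have "hausdorff_dim S \<le> ennreal (1 + e)"
    unfolding hausdorff_dim_def using \<open>e > 0\<close> by (intro INF_lower) auto
  then show "hausdorff_dim S \<le> 1 + ennreal e" using \<open>e > 0\<close> by simp
qed

text \<open>
  This replaces the mass distribution principle. The sets of a cover of \<open>S\<close> pull back under \<open>h\<close> to
  sets of length \<open>O(diameter powr t)\<close> that cover the unit interval. As the unit interval has length
  \<open>1\<close>, the sum of the weights for the exponent \<open>t\<close> is bounded below, and for diameters at most \<open>1\<close> a
  smaller exponent only increases the weights.
\<close>

lemma hausdorff_dim_ge_if_inverse_holder:
  fixes S :: "'a::metric_space set" and h :: "real \<Rightarrow> 'a"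
  assumes h: "h ` {0..<1} \<subseteq> S" and C: "C > 0" and t: "t > 0"
    and holder: "\<And>x y. x \<in> {0..<1} \<Longrightarrow> y \<in> {0..<1} \<Longrightarrow> \<bar>x - y\<bar> \<le> C * dist (h x) (h y) powr t"
  shows "ennreal t \<le> hausdorff_dim S"
  unfolding hausdorff_dim_def
proof (rule INF_greatest, clarify, rule ccontr)
  fix s assume s: "0 \<le> s" "hausdorff_measure s S = 0" "\<not> ennreal t \<le> ennreal s"
  then have "s < t" by (simp add: ennreal_le_iff)
  have "ennreal (1 / (2 * C)) \<le> (\<Sum>i. hausdorff_weight s (U i))" if U: "U \<in> delta_covers 1 S" for U
  proof -
    define W where "W i = (if \<exists>y\<in>{0..<1}. h y \<in> U i
        then cball (SOME y. y \<in> {0..<1} \<and> h y \<in> U i) (C * diameter (U i) powr t) else {})" for i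
    have bdd: "bounded (U i)" and diam: "0 \<le> diameter (U i)" "diameter (U i) \<le> 1" for i
      using U by (auto simp: delta_covers_def diameter_ge_0)
    have W: "y \<in> W i" if y: "y \<in> {0..<1}" "h y \<in> U i" for y i
    proof -
      define z where "z = (SOME y. y \<in> {0..<1} \<and> h y \<in> U i)"
      have z: "z \<in> {0..<1} \<and> h z \<in> U i"
        unfolding z_def by (rule someI[of _ y]) (use y in blast)
      have "\<bar>z - y\<bar> \<le> C * dist (h z) (h y) powr t" using holder y z by blast
      also have "\<dots> \<le> C * diameter (U i) powr t"
        using C t z y diameter_bounded_bound[OF bdd] by (intro mult_left_mono powr_mono2) auto
      finally show ?thesis using y by (auto simp: W_def z_def dist_real_def)
    qed
    have W_weight: "emeasure lborel (W i) \<le> ennreal (2 * C) * hausdorff_weight s (U i)" for i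
    proof (cases "W i = {}")
      case False
      then have ne: "U i \<noteq> {}" by (auto simp: W_def split: if_splits)
      have "emeasure lborel (W i) \<le> ennreal (2 * (C * diameter (U i) powr t))"
        using C by (auto simp: W_def cball_eq_atLeastAtMost)
      also have "\<dots> = ennreal (2 * C) * ennreal (diameter (U i) powr t)"
        using C by (simp add: ennreal_mult[symmetric] mult_ac)
      also have "ennreal (diameter (U i) powr t) \<le> hausdorff_weight s (U i)"
      proof (cases "s = 0")
        case True
        then show ?thesis
          using ne diam[of i] t powr_mono2[of t "diameter (U i)" 1]
          by (simp add: hausdorff_weight_def)
      next
        case False
        then show ?thesis
          using ne diam[of i] t powr_mono'[of s t "diameter (U i)"] \<open>s < t\<close>
          by (simp add: hausdorff_weight_def ennreal_leI)
      qed
      finally show ?thesis by (simp add: mult_left_mono)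
    qed auto
    have "{0..<1} \<subseteq> (\<Union>i. W i)"
    proof
      fix y :: real assume y: "y \<in> {0..<1}"
      then have "h y \<in> S" using h by blast
      then have "h y \<in> (\<Union>i. U i)" using U by (auto simp: delta_covers_def)
      then show "y \<in> (\<Union>i. W i)" using W y by blast
    qed
    then have "emeasure lborel {0..<1::real} \<le> emeasure lborel (\<Union>i. W i)"
      by (intro emeasure_mono) (auto simp: W_def)
    also have "\<dots> \<le> (\<Sum>i. emeasure lborel (W i))"
      by (intro emeasure_subadditive_countably) (auto simp: W_def)
    also have "\<dots> \<le> (\<Sum>i. ennreal (2 * C) * hausdorff_weight s (U i))"
      by (intro suminf_le W_weight) auto
    also have "\<dots> = ennreal (2 * C) * (\<Sum>i. hausdorff_weight s (U i))"
      by simp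
    finally have "1 \<le> ennreal (2 * C) * (\<Sum>i. hausdorff_weight s (U i))"
      by simp
    then have "ennreal (1 / (2 * C)) * 1
        \<le> ennreal (1 / (2 * C)) * (ennreal (2 * C) * (\<Sum>i. hausdorff_weight s (U i)))"
      by (rule mult_left_mono) auto
    also have "\<dots> = (\<Sum>i. hausdorff_weight s (U i))"
      using C by (simp add: mult.assoc[symmetric] ennreal_mult[symmetric])
    finally show ?thesis by simp
  qed
  then have "ennreal (1 / (2 * C)) \<le> hausdorff_premeasure s 1 S"
    unfolding hausdorff_premeasure_def by (rule INF_greatest)
  also have "\<dots> \<le> hausdorff_measure s S"
    unfolding hausdorff_measure_def by (rule SUP_upper) auto
  finally show False using s C by simp
qed

section \<open>Transcoding base-\<open>M\<close> expansions into base \<open>q\<close>\<close>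

lemma frac_mult_frac: "frac (real a * frac x) = frac (real a * x)"
proof -
  have "real a * frac x = real a * x - of_int (int a * \<lfloor>x\<rfloor>)"
    by (simp add: frac_def algebra_simps)
  then show ?thesis by (simp add: frac_def del: of_int_mult)
qed

locale digit_shift =
  fixes q k M :: nat
  assumes k_pos: "1 \<le> k" and M_ge_2: "2 \<le> M" and k_M_less_q: "k + M < q"
begin

definition digit :: "real \<Rightarrow> nat \<Rightarrow> real" where
  "digit y n = of_int \<lfloor>real M * frac (real M ^ n * y)\<rfloor>"

definition transcode :: "real \<Rightarrow> real" where
  "transcode y = (\<Sum>n. (real k + digit y n) / real q ^ Suc n)"

lemma q_gt_3: "q > 3"
  using k_pos M_ge_2 k_M_less_q by linarith

lemma digit_bounds: "0 \<le> digit y n" "digit y n \<le> real M - 1"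
proof -
  have "\<lfloor>real M * frac (real M ^ n * y)\<rfloor> < int M"
    using M_ge_2 frac_lt_1[of "real M ^ n * y"] by (simp add: floor_less_iff)
  then have "\<lfloor>real M * frac (real M ^ n * y)\<rfloor> \<le> int M - 1" by simp
  then show "digit y n \<le> real M - 1" unfolding digit_def by linarith
qed (simp add: digit_def frac_ge_0)

lemma digit_Suc: "digit y (Suc n) = digit (frac (real M * y)) n"
  using frac_mult_frac[of "M ^ n" "M * y"] by (simp add: digit_def mult_ac)

lemma sums_geometric_q: "(\<lambda>n. (real q - 1) / real q ^ Suc n) sums 1"
proof -
  have "(\<lambda>n. (real q - 1) / real q * (1 / q) ^ n) sums ((real q - 1) / real q * (1 / (1 - 1 / q)))"
    using q_gt_3 by (intro sums_mult geometric_sums) auto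
  moreover have "(real q - 1) / real q * (1 / (1 - 1 / q)) = 1"
    using q_gt_3 by (simp add: field_simps)
  ultimately show ?thesis by (simp only:) (simp add: power_divide)
qed

lemma transcode_term_bounds:
  "0 \<le> (real k + digit y n) / real q ^ Suc n" "(real k + digit y n) / real q ^ Suc n \<le> (real q - 1) / real q ^ Suc n"
  using digit_bounds[of y n] k_M_less_q by (auto intro!: divide_right_mono)

lemma summable_transcode: "summable (\<lambda>n. (real k + digit y n) / real q ^ Suc n)"
  by (rule summable_comparison_test'[OF sums_summable[OF sums_geometric_q], of 0])
     (simp only: real_norm_def abs_of_nonneg transcode_term_bounds)

lemma transcode_nonneg: "0 \<le> transcode y"
  unfolding transcode_def by (intro suminf_nonneg summable_transcode transcode_term_bounds)

lemma transcode_le_1: "transcode y \<le> 1"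
  unfolding transcode_def
  by (rule sums_le[OF _ summable_sums[OF summable_transcode] sums_geometric_q])
     (rule transcode_term_bounds)

text \<open>
  The self-similarity of \<open>transcode\<close> replaces every further use of the series.
\<close>

lemma transcode_step: "real q * transcode y = real k + digit y 0 + transcode (frac (real M * y))"
proof -
  have "transcode (frac (real M * y)) = (\<Sum>n. real q * ((real k + digit y (Suc n)) / real q ^ Suc (Suc n)))"
    using q_gt_3 by (simp add: transcode_def digit_Suc)
  also have "\<dots> = real q * (\<Sum>n. (real k + digit y (Suc n)) / real q ^ Suc (Suc n))"
    using summable_transcode[of y, THEN summable_Suc_iff[THEN iffD2]] by (rule suminf_mult)
  also have "\<dots> = real q * (transcode y - (real k + digit y 0) / q)"
    using suminf_split_head[OF summable_transcode[of y]] by (simp add: transcode_def)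
  finally show ?thesis using q_gt_3 by (simp add: right_diff_distrib)
qed

lemma transcode_ge: "real k / real q \<le> transcode y"
proof -
  have "real k \<le> real q * transcode y"
    unfolding transcode_step[of y] using digit_bounds(1)[of y 0] transcode_nonneg[of "frac (real M * y)"]
    by linarith
  then show ?thesis using q_gt_3 by (simp add: divide_le_eq mult.commute)
qed

text \<open>
  Only digits up to \<open>q - 2\<close> occur, which rules out the value \<open>1 = 0.(q-1)(q-1)\<dots>\<close>.
\<close>

lemma transcode_less_1: "transcode y < 1"
proof -
  have "real q * transcode y < real q * 1"
    using transcode_step[of y] digit_bounds[of y 0] transcode_le_1[of "frac (real M * y)"] k_M_less_q
    by simp
  then show ?thesis by (rule mult_left_less_imp_less) simp
qed

lemma frac_power_mult_transcode: "frac (real q ^ n * transcode y) = transcode (frac (real M ^ n * y))"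
  if "0 \<le> y" "y < 1"
  using that
proof (induction n)
  case 0
  have "frac y = y" "frac (transcode y) = transcode y"
    unfolding frac_eq using that transcode_nonneg transcode_less_1 by auto
  then show ?case by (simp only: power_0 mult_1)
next
  case (Suc n)
  let ?z = "frac (real M ^ n * y)"
  have "frac (real q ^ Suc n * transcode y) = frac (real q * frac (real q ^ n * transcode y))"
    unfolding frac_mult_frac by (simp add: mult_ac)
  also have "\<dots> = frac (real k + digit ?z 0 + transcode (frac (real M * ?z)))"
    using Suc.IH[OF Suc.prems] transcode_step[of ?z] by (simp only:)
  also have "\<dots> = frac (transcode (frac (real M * ?z)) + of_int (int k + \<lfloor>real M * frac ?z\<rfloor>))"
    by (simp add: digit_def add_ac)
  also have "\<dots> = transcode (frac (real M * ?z))"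
    unfolding frac_add_of_int_right frac_eq using transcode_nonneg transcode_less_1 by blast
  also have "frac (real M * ?z) = frac (real M ^ Suc n * y)"
    unfolding frac_mult_frac by (simp add: mult_ac)
  finally show ?case .
qed

lemma transcode_in_F_set:
  assumes "0 \<le> y" "y < 1" "c \<le> real k / real q"
  shows "transcode y \<in> F_set q c"
proof -
  have "c \<le> frac (real q ^ n * transcode y)" for n
    unfolding frac_power_mult_transcode[OF assms(1,2)] using assms(3) transcode_ge by (rule order_trans)
  then show ?thesis
    by (simp add: F_set_def transcode_nonneg transcode_less_1)
qed

text \<open>
  Two points at distance at least \<open>M^(-n)\<close> differ in one of the first \<open>n\<close> base-\<open>M\<close> digits. At the
  first such digit, after scaling by the matching power of \<open>q\<close>, the leading digits contribute at
  least \<open>1\<close> to the difference of the images, and the tails, which lie in the interval from \<open>k / q\<close> to \<open>1\<close>, cannot cancel more than \<open>1 - k / q\<close> of it.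
  What remains is positive because \<open>k \<ge> 1\<close>.
\<close>

lemma transcode_separation:
  assumes "0 \<le> x" "x < 1" "0 \<le> y" "y < 1" "1 / real M ^ n \<le> y - x"
  shows "1 / real q ^ Suc n \<le> transcode y - transcode x"
  using assms
proof (induction n arbitrary: x y)
  case (Suc n)
  let ?x = "frac (real M * x)" and ?y = "frac (real M * y)"
  have digit_0: "digit z 0 = of_int \<lfloor>real M * z\<rfloor>" if "0 \<le> z" "z < 1" for z
    using that by (simp add: digit_def frac_eq[THEN iffD2])
  have diff: "real q * (transcode y - transcode x)
      = of_int (\<lfloor>real M * y\<rfloor> - \<lfloor>real M * x\<rfloor>) + (transcode ?y - transcode ?x)"
    using transcode_step[of x] transcode_step[of y] digit_0[of x] digit_0[of y] Suc.prems
    by (simp add: algebra_simps)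
  have "0 < 1 / real M ^ Suc n" using M_ge_2 by simp
  then have "x \<le> y" using Suc.prems by linarith
  then have "\<lfloor>real M * x\<rfloor> \<le> \<lfloor>real M * y\<rfloor>" by (intro floor_mono mult_left_mono) auto
  then consider (eq) "\<lfloor>real M * x\<rfloor> = \<lfloor>real M * y\<rfloor>" | (less) "1 \<le> \<lfloor>real M * y\<rfloor> - \<lfloor>real M * x\<rfloor>"
    by linarith
  then have "1 / real q ^ Suc n \<le> real q * (transcode y - transcode x)"
  proof cases
    case eq
    have "1 / real M ^ n \<le> real M * (y - x)"
      using Suc.prems(5) M_ge_2 by (simp add: field_simps)
    then have "1 / real M ^ n \<le> ?y - ?x"
      using eq by (simp add: frac_def algebra_simps)
    then have "1 / real q ^ Suc n \<le> transcode ?y - transcode ?x"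
      by (intro Suc.IH frac_ge_0 frac_lt_1)
    then show ?thesis using diff eq by simp
  next
    case less
    then have "(1::real) \<le> of_int (\<lfloor>real M * y\<rfloor> - \<lfloor>real M * x\<rfloor>)" by linarith
    then have "real k / real q \<le> real q * (transcode y - transcode x)"
      unfolding diff using transcode_ge[of ?y] transcode_less_1[of ?x] by linarith
    moreover have "1 / real q ^ Suc n \<le> real k / real q"
    proof (rule frac_le)
      show "real q \<le> real q ^ Suc n" using q_gt_3 by (intro self_le_power) auto
    qed (use k_pos q_gt_3 in auto)
    ultimately show ?thesis by linarith
  qed
  then show ?case using q_gt_3 by (simp add: field_simps)
qed simp

lemma transcode_holder:
  assumes x: "x \<in> {0..<1}" and y: "y \<in> {0..<1}"
  shows "\<bar>x - y\<bar> \<le> real M ^ 2 * dist (transcode x) (transcode y) powr (ln (real M) / ln (real q))"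
proof -
  have *: "y - x \<le> real M ^ 2 * dist (transcode x) (transcode y) powr (ln (real M) / ln (real q))"
    if "0 \<le> x" "x < 1" "0 \<le> y" "y < 1" "x < y" for x y
  proof -
    have "\<exists>n. (1 / M) ^ n < y - x"
      using that M_ge_2 by (intro real_arch_pow_inv) auto
    then have ex: "\<exists>n. 1 / real M ^ n \<le> y - x" by (auto simp: power_divide intro: less_imp_le)
    define n where "n = (LEAST n. 1 / real M ^ n \<le> y - x)"
    have n: "1 / real M ^ n \<le> y - x" unfolding n_def using ex by (rule LeastI_ex)
    then have "n \<noteq> 0" using that by (intro notI) simp
    then obtain m where m: "n = Suc m" using not0_implies_Suc by blast
    then have "y - x \<le> 1 / real M ^ m"
      using not_less_Least[of m "\<lambda>n. 1 / real M ^ n \<le> y - x"] unfolding n_def by auto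
    also have "\<dots> = real M ^ 2 * (1 / real M ^ Suc n)"
      using m M_ge_2 by (simp add: power2_eq_square)
    \<comment> \<open>The exponent is chosen so that powers of \<open>q\<close> become powers of \<open>M\<close>.\<close>
    also have "1 / real M ^ Suc n = (1 / real q ^ Suc n) powr (ln (real M) / ln (real q))"
    proof -
      have "real q powr (ln (real M) / ln (real q)) = M" using M_ge_2 q_gt_3 by (simp add: powr_def)
      moreover have "(1 / real q ^ Suc n) powr (ln (real M) / ln (real q)) = 1 / (real q powr (ln (real M) / ln (real q))) ^ Suc n"
        using q_gt_3 by (simp add: powr_divide powr_mult powr_power powr_powr
            powr_realpow[symmetric] mult_ac del: power_Suc)
      ultimately show ?thesis by simp
    qed
    also have "\<dots> \<le> dist (transcode x) (transcode y) powr (ln (real M) / ln (real q))"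
      using transcode_separation[OF that(1-4) n] M_ge_2 q_gt_3
      by (intro powr_mono2) (auto simp: dist_real_def)
    finally show ?thesis by (simp add: mult_left_mono)
  qed
  consider "x < y" | "x = y" | "y < x" by linarith
  then show ?thesis
    using *[of x y] *[of y x] x y by cases (auto simp: dist_commute)
qed

lemma hausdorff_dim_F_set_ge:
  assumes "c \<le> real k / real q"
  shows "ennreal (ln (real M) / ln (real q)) \<le> hausdorff_dim (F_set q c)"
proof (rule hausdorff_dim_ge_if_inverse_holder)
  show "transcode ` {0..<1} \<subseteq> F_set q c" using transcode_in_F_set assms by auto
qed (use transcode_holder M_ge_2 q_gt_3 in auto)

end

section \<open>The limit\<close>

lemma F_set_subset: "F_set q c \<subseteq> {0..<1}"
  by (auto simp: F_set_def)

lemma phi_le_1: "phi q c \<le> 1"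
  unfolding phi_def
  by (rule enn2real_leI) (use hausdorff_dim_unit_interval_le_1[OF F_set_subset] in auto)

lemma phi_ge:
  fixes c :: real
  assumes c: "0 \<le> c" and q: "(1 - c) * real q \<ge> 4"
  shows "ln ((1 - c) * real q - 2) / ln (real q) \<le> phi q c"
proof -
  \<comment> \<open>Rounding \<open>c q\<close> strictly upwards makes \<open>k\<close> positive even for \<open>c = 0\<close>; the digits \<open>k\<close> to
    \<open>q - 2\<close> are then allowed.\<close>
  define k where "k = nat \<lfloor>c * real q\<rfloor> + 1"
  define M where "M = q - 1 - k"
  have k: "c * real q \<le> k" "k \<le> c * real q + 1"
  proof -
    have "real k = of_int \<lfloor>c * real q\<rfloor> + 1" using c by (simp add: k_def)
    then show "c * real q \<le> k" "k \<le> c * real q + 1" by linarith+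
  qed
  have "real k + 3 \<le> q" using k q by (simp add: algebra_simps)
  then have "k + 3 \<le> q" by linarith
  then have M: "real M = q - 1 - real k" "2 \<le> M" "k + M < q" by (auto simp: M_def)
  interpret digit_shift q k M
    by unfold_locales (use M in \<open>auto simp: k_def\<close>)
  have "(1 - c) * real q - 2 \<le> M" using M k by (simp add: algebra_simps)
  then have "ln ((1 - c) * real q - 2) / ln (real q) \<le> ln (real M) / ln (real q)"
    using q q_gt_3 M by (intro divide_right_mono) auto
  also have "\<dots> = enn2real (ennreal (ln (real M) / ln (real q)))"
    using M q_gt_3 by (simp add: divide_nonneg_nonneg)
  also have "\<dots> \<le> phi q c"
    unfolding phi_def
  proof (rule enn2real_mono)
    show "ennreal (ln (real M) / ln (real q)) \<le> hausdorff_dim (F_set q c)"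
      using k q_gt_3 by (intro hausdorff_dim_F_set_ge) (simp add: field_simps)
    show "hausdorff_dim (F_set q c) < top"
      using hausdorff_dim_unit_interval_le_1[OF F_set_subset] by (rule le_less_trans) simp
  qed
  finally show ?thesis .
qed

lemma tendsto_phi:
  fixes c :: real
  assumes "0 \<le> c" "c < 1"
  shows "(\<lambda>q. phi q c) \<longlonglongrightarrow> 1"
proof (rule tendsto_sandwich)
  define a where "a = 1 - c"
  have a: "a > 0" using assms by (simp add: a_def)
  have "\<forall>\<^sub>F q :: nat in sequentially. a * real q \<ge> 4" using a by real_asymp
  then show "\<forall>\<^sub>F q in sequentially. ln ((1 - c) * real q - 2) / ln (real q) \<le> phi q c"
    by eventually_elim (use phi_ge assms in \<open>simp add: a_def\<close>)
  have "(\<lambda>q::nat. ln (a * real q - 2) / ln (real q)) \<longlonglongrightarrow> 1" using a by real_asymp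
  then show "(\<lambda>q::nat. ln ((1 - c) * real q - 2) / ln (real q)) \<longlonglongrightarrow> 1" by (simp add: a_def)
qed (auto simp: phi_le_1)

lemma tendsto_psi:
  fixes c :: real
  assumes "c < 1"
  shows "(\<lambda>q. psi q c) \<longlonglongrightarrow> 1"
proof -
  define L where "L = ln (1 - c)"
  have "(\<lambda>q::nat. 1 + L / ln (real q)) \<longlonglongrightarrow> 1" by real_asymp
  moreover have "\<forall>\<^sub>F q :: nat in sequentially. c < (real q - 1) / real q"
    by (rule order_tendstoD(1)[OF _ assms]) real_asymp
  then have "\<forall>\<^sub>F q in sequentially. 1 + L / ln (real q) = psi q c"
    by eventually_elim (simp add: psi_def L_def)
  ultimately show ?thesis by (rule Lim_transform_eventually)
qed

theorem theorem23:
  fixes c :: real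
  assumes "0 \<le> c" and "c < 1"
  shows "(\<lambda>q::nat. phi q c / psi q c) \<longlonglongrightarrow> 1"
  using tendsto_divide[OF tendsto_phi tendsto_psi, of c c] assms by simp

end
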